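(* For every integer $d\ge 1$, the function $\delta\mapsto\psi(d,\delta,\lambda(d,\delta))$ is (strictly) increasing on the integers $\delta\ge 1$; that is, $\psi(d,\delta+1,\lambda(d,\delta+1))>\psi(d,\delta,\lambda(d,\delta))$ for all integers $\delta\ge 1$, where $\psi$ and $\lambda(d,\delta)$ are as defined in the context.
   Context: For integers $d,\delta,p\ge 1$ with $p\ge\delta d$, define $$\psi(d,\delta,p):=\frac{\delta d^2(p-\delta+1)}{p-\delta d+1}+d(p-\delta+1)-1.$$ For $d\ge 2$, put $p_1:=\delta d-1+\lfloor\delta\sqrt{d^2-d}\rfloor$ and $p_2:=p_1+1$ (both are $\ge\delta d$), and define $\lambda(d,\delta):=p_1$ if $\psi(d,\delta,p_1)\le\psi(d,\delta,p_2)$, and $\lambda(d,\delta):=p_2$ if $\psi(d,\delta,p_2)<\psi(d,\delta,p_1)$. For $d=1$, put $\lambda(1,\delta):=\delta$. *)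

theory Defs
  imports Complex_Main
begin

definition psi :: "int \<Rightarrow> int \<Rightarrow> int \<Rightarrow> real" where
  "psi d \<delta> p =
     real_of_int (\<delta> * d\<^sup>2 * (p - \<delta> + 1)) / real_of_int (p - \<delta> * d + 1)
     + real_of_int (d * (p - \<delta> + 1) - 1)"

definition p1 :: "int \<Rightarrow> int \<Rightarrow> int" where
  "p1 d \<delta> = \<delta> * d - 1 + \<lfloor>real_of_int \<delta> * sqrt (real_of_int (d\<^sup>2 - d))\<rfloor>"

definition p2 :: "int \<Rightarrow> int \<Rightarrow> int" where
  "p2 d \<delta> = p1 d \<delta> + 1"

(* Only used for d, \<delta> \<ge> 1, where every p involved satisfies p \<ge> \<delta> * d,
   so the denominator in psi is positive. *)
definition lam :: "int \<Rightarrow> int \<Rightarrow> int" where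
  "lam d \<delta> =
     (if d = 1 then \<delta>
      else if psi d \<delta> (p1 d \<delta>) \<le> psi d \<delta> (p2 d \<delta>) then p1 d \<delta>
      else p2 d \<delta>)"

end

theory Submission
  imports Defs
begin

text \<open>
  Substitute \<open>p = q + \<delta> d - 1\<close>. The denominator becomes \<open>q\<close>, and
  \<open>\<psi> = d q + \<delta>\<^sup>2 d\<^sup>2 (d - 1) / q + \<delta> (2 d\<^sup>2 - d) - 1\<close>.
  For fixed \<open>\<delta>\<close> this is a convex function of \<open>q > 0\<close> with its minimum at
  \<open>s = \<delta> \<surd>(d\<^sup>2 - d)\<close>. The candidates \<open>p\<^sub>1\<close> and \<open>p\<^sub>2\<close> are the integers \<open>q = \<lfloor>s\<rfloor>\<close> and
  \<open>q = \<lfloor>s\<rfloor> + 1\<close> around it, so \<open>\<lambda>(d,\<delta>)\<close> minimises \<open>\<psi>(d,\<delta>,\<cdot>)\<close> over all integers \<open>q \<ge> 1\<close>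
  (\<open>psi_lam_minimal\<close>). For fixed \<open>q \<ge> 1\<close> on the other hand, \<open>\<psi>\<close> visibly increases
  with \<open>\<delta>\<close> (\<open>psi_shift_strict_mono\<close>). A minimum over a set of \<open>q\<close> that is the same
  for every \<open>\<delta>\<close>, of functions that all increase with \<open>\<delta>\<close>, increases with \<open>\<delta>\<close>:
  if \<open>q\<close> attains the minimum for \<open>\<epsilon> > \<delta>\<close>, then the value there exceeds the value at
  the same \<open>q\<close> for \<open>\<delta>\<close>, which is at least the minimum for \<open>\<delta>\<close>.
  The case \<open>d = 1\<close> is separate, because the real minimum \<open>s = 0\<close> then lies outside the
  domain; there \<open>\<psi>(1,\<delta>,\<delta>) = \<delta>\<close>.
\<close>

lemma psi_shift:
  fixes d \<delta> q :: int
  assumes "q \<ge> 1"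
  shows "psi d \<delta> (q + \<delta> * d - 1) =
    d * real_of_int q + (real_of_int \<delta>)\<^sup>2 * d\<^sup>2 * (d - 1) / q + \<delta> * (2 * (real_of_int d)\<^sup>2 - d) - 1"
  using assms unfolding psi_def by (simp add: field_simps power2_eq_square)

lemma psi_shift_strict_mono:
  fixes d \<delta> \<epsilon> q :: int
  assumes "d \<ge> 1" "0 \<le> \<delta>" "\<delta> < \<epsilon>" "q \<ge> 1"
  shows "psi d \<delta> (q + \<delta> * d - 1) < psi d \<epsilon> (q + \<epsilon> * d - 1)"
proof -
  have "(real_of_int \<delta>)\<^sup>2 * d\<^sup>2 * (d - 1) / q \<le> (real_of_int \<epsilon>)\<^sup>2 * d\<^sup>2 * (d - 1) / q"
    using assms by (intro divide_right_mono mult_right_mono power_mono) auto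
  moreover have "\<delta> * (2 * (real_of_int d)\<^sup>2 - d) < \<epsilon> * (2 * (real_of_int d)\<^sup>2 - d)"
  proof (rule mult_strict_right_mono)
    have "real_of_int d * 1 \<le> real_of_int d * d"
      using assms by (intro mult_left_mono) auto
    moreover have "0 < real_of_int d"
      using assms by simp
    ultimately show "0 < 2 * (real_of_int d)\<^sup>2 - d"
      unfolding power2_eq_square by linarith
  qed (use assms in simp)
  ultimately show ?thesis
    using assms(4) by (simp add: psi_shift)
qed

text \<open>
  For \<open>c > 0\<close> and \<open>a < b\<close> the sign is that of \<open>s\<^sup>2 - a b\<close>. This makes
  \<open>x \<mapsto> c x + c s\<^sup>2 / x\<close> antitone to the left of \<open>s\<close> and monotone to the right of \<open>s\<close>
  without any use of derivatives.
\<close>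

lemma add_inverse_diff:
  fixes a b c s :: real
  assumes "a > 0" "b > 0"
  shows "(c * a + c * s\<^sup>2 / a) - (c * b + c * s\<^sup>2 / b) = c * (b - a) * (s\<^sup>2 - a * b) / (a * b)"
  using assms by (simp add: field_simps power2_eq_square)

lemma add_inverse_antimono:
  fixes a b c s :: real
  assumes "0 < a" "a \<le> b" "b \<le> s" "0 \<le> c"
  shows "c * b + c * s\<^sup>2 / b \<le> c * a + c * s\<^sup>2 / a"
proof -
  have "a * b \<le> s * s"
    using assms by (intro mult_mono) auto
  then have "0 \<le> c * (b - a) * (s\<^sup>2 - a * b) / (a * b)"
    using assms by (simp add: power2_eq_square)
  then show ?thesis
    using add_inverse_diff[of a b c s] assms by linarith
qed

lemma add_inverse_mono:
  fixes a b c s :: real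
  assumes "0 < a" "a \<le> b" "0 \<le> s" "s \<le> a" "0 \<le> c"
  shows "c * a + c * s\<^sup>2 / a \<le> c * b + c * s\<^sup>2 / b"
proof -
  have "s * s \<le> a * b"
    using assms by (intro mult_mono) auto
  then have "0 \<le> c * (a - b) * (s\<^sup>2 - b * a) / (b * a)"
    using assms
    by (intro divide_nonneg_pos mult_nonpos_nonpos mult_nonneg_nonpos)
      (auto simp: power2_eq_square mult.commute)
  then show ?thesis
    using add_inverse_diff[of b a c s] assms by linarith
qed

lemma lam_domain:
  fixes d \<delta> :: int
  assumes "d \<ge> 2" "\<delta> \<ge> 1"
  obtains q where "q \<ge> 1" "lam d \<delta> = q + \<delta> * d - 1"
proof -
  have "d * 1 \<le> d * (d - 1)"
    using assms by (intro mult_left_mono) auto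
  then have "1 \<le> d\<^sup>2 - d"
    using assms unfolding power2_eq_square right_diff_distrib by linarith
  then have "1 \<le> sqrt (real_of_int (d\<^sup>2 - d))"
    by (simp only: real_sqrt_ge_1_iff of_int_1_le_iff)
  then have "1 * 1 \<le> real_of_int \<delta> * sqrt (real_of_int (d\<^sup>2 - d))"
    using assms by (intro mult_mono) auto
  then have "1 \<le> \<lfloor>real_of_int \<delta> * sqrt (real_of_int (d\<^sup>2 - d))\<rfloor>"
    by (simp add: le_floor_iff)
  then have "1 \<le> lam d \<delta> - \<delta> * d + 1"
    using assms unfolding lam_def p2_def p1_def by auto
  then show thesis
    by (intro that[of "lam d \<delta> - \<delta> * d + 1"]) auto
qed

text \<open>
  The function is monotone on each side of the real minimum \<open>s\<close>, so an integer \<open>q\<close> does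
  no better than \<open>\<lfloor>s\<rfloor>\<close> if \<open>q \<le> \<lfloor>s\<rfloor>\<close> and no better than \<open>\<lfloor>s\<rfloor> + 1\<close> otherwise;
  \<open>\<lambda>\<close> picks the better of these two.
\<close>

lemma psi_lam_minimal:
  fixes d \<delta> q :: int
  assumes "d \<ge> 2" "\<delta> \<ge> 1" "q \<ge> 1"
  shows "psi d \<delta> (lam d \<delta>) \<le> psi d \<delta> (q + \<delta> * d - 1)"
proof -
  define s where "s = real_of_int \<delta> * sqrt (real_of_int (d\<^sup>2 - d))"
  define m where "m = \<lfloor>s\<rfloor>"
  have d: "0 \<le> d\<^sup>2 - d"
    using assms by (simp add: power2_eq_square)
  have s0: "0 \<le> s"
    unfolding s_def using assms d by (intro mult_nonneg_nonneg) auto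
  have "s\<^sup>2 = (real_of_int \<delta>)\<^sup>2 * real_of_int (d\<^sup>2 - d)"
    unfolding s_def power_mult_distrib using d by (simp only: real_sqrt_pow2 of_int_0_le_iff)
  moreover have "(real_of_int \<delta>)\<^sup>2 * d\<^sup>2 * (d - 1) = d * ((real_of_int \<delta>)\<^sup>2 * real_of_int (d\<^sup>2 - d))"
    by (simp add: power2_eq_square algebra_simps)
  ultimately have s2: "(real_of_int \<delta>)\<^sup>2 * d\<^sup>2 * (d - 1) = d * s\<^sup>2"
    by simp
  have psi: "psi d \<delta> (k + \<delta> * d - 1) =
      (d * real_of_int k + d * s\<^sup>2 / k) + \<delta> * (2 * (real_of_int d)\<^sup>2 - d) - 1" if "k \<ge> 1" for k :: int
    using psi_shift[OF that, of d \<delta>] unfolding s2 by simp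
  have p1: "p1 d \<delta> = m + \<delta> * d - 1" and p2: "p2 d \<delta> = (m + 1) + \<delta> * d - 1"
    unfolding p2_def p1_def m_def s_def by simp_all
  have lam: "psi d \<delta> (lam d \<delta>) \<le> psi d \<delta> (p1 d \<delta>)" "psi d \<delta> (lam d \<delta>) \<le> psi d \<delta> (p2 d \<delta>)"
    using assms unfolding lam_def by auto
  show ?thesis
  proof (cases "q \<le> m")
    case True
    have "d * real_of_int m + d * s\<^sup>2 / m \<le> d * real_of_int q + d * s\<^sup>2 / q"
      using assms True by (intro add_inverse_antimono) (auto simp: m_def)
    then have "psi d \<delta> (p1 d \<delta>) \<le> psi d \<delta> (q + \<delta> * d - 1)"
      using assms True by (simp add: p1 psi)
    then show ?thesis
      using lam by linarith
  next
    case False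
    have m: "0 \<le> m"
      using s0 by (simp add: m_def)
    have "s \<le> real_of_int (m + 1)"
      unfolding m_def by linarith
    then have "d * real_of_int (m + 1) + d * s\<^sup>2 / real_of_int (m + 1)
        \<le> d * real_of_int q + d * s\<^sup>2 / q"
      using assms False m s0 by (intro add_inverse_mono) linarith+
    then have "psi d \<delta> (p2 d \<delta>) \<le> psi d \<delta> (q + \<delta> * d - 1)"
      using assms m psi[of "m + 1"] psi[of q] unfolding p2 by linarith
    then show ?thesis
      using lam by linarith
  qed
qed

lemma psi_lam_strict_mono:
  fixes d \<delta> \<epsilon> :: int
  assumes "d \<ge> 1" "1 \<le> \<delta>" "\<delta> < \<epsilon>"
  shows "psi d \<delta> (lam d \<delta>) < psi d \<epsilon> (lam d \<epsilon>)"
proof (cases "d = 1")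
  case True
  then show ?thesis
    using assms by (simp add: psi_def lam_def)
next
  case False
  then have d: "d \<ge> 2"
    using assms by simp
  obtain q where q: "q \<ge> 1" "lam d \<epsilon> = q + \<epsilon> * d - 1"
    using lam_domain[OF d, of \<epsilon>] assms by auto
  have "psi d \<delta> (lam d \<delta>) \<le> psi d \<delta> (q + \<delta> * d - 1)"
    using psi_lam_minimal d assms q by blast
  also have "\<dots> < psi d \<epsilon> (q + \<epsilon> * d - 1)"
    using psi_shift_strict_mono[of d \<delta> \<epsilon> q] assms q by simp
  finally show ?thesis
    by (simp add: q)
qed

theorem mainTheorem4:
  fixes d :: int
  assumes "d \<ge> 1"
  shows "strict_mono_on {1..} (\<lambda>\<delta>::int. psi d \<delta> (lam d \<delta>))
       \<and> (\<forall>\<delta>::int. \<delta> \<ge> 1 \<longrightarrow> psi d (\<delta> + 1) (lam d (\<delta> + 1)) > psi d \<delta> (lam d \<delta>))"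
  using psi_lam_strict_mono[OF assms] by (auto intro!: strict_mono_onI)

end
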